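(* Let $n\ge2$, let $0\le\sigma_j<1$ for $1\le j\le n$, and set $\alpha_j=\sqrt{1-\sigma_j^2}$. Assume that \[ \sum_{j=1}^n\alpha_j>n-1 . \] Then there is a reduced pointed degree-three sphere map (from $\mathbb B^n$ to some $\mathbb B^N$) with denominator $g(z)=1+\sum_{j=1}^n\sigma_jz_j^2$.
   Context: $\mathbb B^n$ is the open unit ball of $\mathbb C^n$. A (rational) sphere map with denominator $g$ is a rational map $F=P/g$, holomorphic on $\mathbb B^n$, with $P=(p_1,\dots,p_N)^t\colon\mathbb C^n\to\mathbb C^N$ a polynomial map and $\|P(z)\|^2=|g(z)|^2$ for all $z\in\partial\mathbb B^n$. It is reduced if $g,p_1,\dots,p_N$ have no common nonconstant polynomial factor; then $\deg F=\max\{\deg P,\deg g\}$. With $g(0)=1$, it is pointed if $P(0)=0$. *)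

theory Defs
  imports "HOL-Analysis.Analysis" "HOL-Library.Poly_Mapping"
begin

text \<open>
  Complex polynomials in the variables \<open>z\<^sub>i\<close>, \<open>i :: 'n\<close>: finitely supported maps from
  exponent vectors to coefficients, with the ring structure (and hence divisibility)
  of \<^theory>\<open>HOL-Library.Poly_Mapping\<close>.
\<close>
type_synonym 'n cpoly = "('n \<Rightarrow>\<^sub>0 nat) \<Rightarrow>\<^sub>0 complex"

definition cpoly_const :: "complex \<Rightarrow> 'n cpoly" where
  "cpoly_const c = Poly_Mapping.single 0 c"

definition cpoly_var :: "'n \<Rightarrow> 'n cpoly" where
  "cpoly_var i = Poly_Mapping.single (Poly_Mapping.single i 1) 1"

definition cpoly_eval :: "'n::finite cpoly \<Rightarrow> complex ^ 'n \<Rightarrow> complex" where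
  "cpoly_eval p z =
     (\<Sum>m\<in>Poly_Mapping.keys p.
        Poly_Mapping.lookup p m * (\<Prod>i\<in>UNIV. (z $ i) ^ Poly_Mapping.lookup m i))"

text \<open>Total degree; the zero polynomial gets degree 0.\<close>
definition cpoly_degree :: "'n::finite cpoly \<Rightarrow> nat" where
  "cpoly_degree p =
     Max (insert 0 ((\<lambda>m. \<Sum>i\<in>UNIV. Poly_Mapping.lookup m i) ` Poly_Mapping.keys p))"

text \<open>Holomorphy in several variables: complex differentiability (intended for open \<open>S\<close>).\<close>
definition holomorphic_multi_on :: "(complex ^ 'n::finite \<Rightarrow> complex) \<Rightarrow> (complex ^ 'n) set \<Rightarrow> bool" where
  "holomorphic_multi_on f S \<longleftrightarrow>
     (\<forall>z\<in>S. \<exists>L. (f has_derivative L) (at z) \<and> (\<forall>c v. L (c *s v) = c * L v))"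

text \<open>
  A polynomial map \<open>P\<close> into \<open>\<complex>\<^sup>N\<close> is a family \<open>P 0, \<dots>, P (N - 1)\<close>, and similarly for a map
  \<open>F\<close> into \<open>\<complex>\<^sup>N\<close>.  Since \<open>g\<close> is not the zero polynomial, the equation \<open>g F = P\<close> says that \<open>F\<close>
  is the rational map \<open>P/g\<close>; stating it without a division avoids the convention
  \<open>x / 0 = 0\<close> at zeros of \<open>g\<close>, where \<open>F\<close> is the holomorphic extension of \<open>P/g\<close>.
\<close>
definition sphere_map ::
  "nat \<Rightarrow> (nat \<Rightarrow> complex ^ 'n::finite \<Rightarrow> complex) \<Rightarrow> (nat \<Rightarrow> 'n cpoly) \<Rightarrow> 'n cpoly \<Rightarrow> bool" where
  "sphere_map N F P g \<longleftrightarrow>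
     g \<noteq> 0 \<and>
     (\<forall>k<N. holomorphic_multi_on (F k) (ball 0 1)) \<and>
     (\<forall>k<N. \<forall>z\<in>ball 0 1. cpoly_eval g z * F k z = cpoly_eval (P k) z) \<and>
     (\<forall>z\<in>sphere 0 1. (\<Sum>k<N. (cmod (cpoly_eval (P k) z))\<^sup>2) = (cmod (cpoly_eval g z))\<^sup>2)"

definition reduced_map :: "nat \<Rightarrow> (nat \<Rightarrow> 'n::finite cpoly) \<Rightarrow> 'n cpoly \<Rightarrow> bool" where
  "reduced_map N P g \<longleftrightarrow>
     (\<forall>h. h dvd g \<longrightarrow> (\<forall>k<N. h dvd P k) \<longrightarrow> cpoly_degree h = 0)"

text \<open>The degree of the rational map \<open>P/g\<close>, provided that it is reduced.\<close>
definition map_degree :: "nat \<Rightarrow> (nat \<Rightarrow> 'n::finite cpoly) \<Rightarrow> 'n cpoly \<Rightarrow> nat" where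
  "map_degree N P g = Max (insert (cpoly_degree g) ((\<lambda>k. cpoly_degree (P k)) ` {..<N}))"

definition pointed_map :: "nat \<Rightarrow> (nat \<Rightarrow> 'n::finite cpoly) \<Rightarrow> 'n cpoly \<Rightarrow> bool" where
  "pointed_map N P g \<longleftrightarrow> cpoly_eval g 0 = 1 \<and> (\<forall>k<N. cpoly_eval (P k) 0 = 0)"

end

theory Submission
  imports Defs "HOL-Computational_Algebra.Fundamental_Theorem_Algebra"
begin

text \<open>
  Let \<open>q = \<Sum>j. \<sigma> j z\<^sub>j\<^sup>2\<close> and \<open>g = 1 + q\<close>. A sphere map \<open>P / g\<close> is the same as a way to write
  \<open>\<bar>g\<bar>\<^sup>2 - (1 - \<parallel>z\<parallel>\<^sup>2) R\<close> as a squared norm \<open>\<parallel>P\<parallel>\<^sup>2\<close>, for some Hermitian polynomial \<open>R\<close>. The proof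
  takes \<open>R = \<bar>g\<bar>\<^sup>2 + (1 + \<parallel>z\<parallel>\<^sup>2) A\<close> with \<open>A = \<Sum>j. a j \<bar>z\<^sub>j\<bar>\<^sup>2\<close> and positive weights \<open>a j < 1\<close>, so that

    \<open>\<parallel>P\<parallel>\<^sup>2 = \<parallel>z\<parallel>\<^sup>2 \<bar>g\<bar>\<^sup>2 - (1 - \<parallel>z\<parallel>\<^sup>4) A\<close>.

  With \<open>a = 0\<close> this is the trivial solution \<open>P = g z\<close>, which represents the identity map; the
  weights perturb it to a map of degree three.

  What has to be shown is that the right-hand side is a sum of squared moduli of polynomials of
  degree at most three. Completing squares in the terms \<open>\<bar>z\<^sub>j\<bar>\<^sup>2 (\<bar>1 + q\<bar>\<^sup>2 - a j)\<close> leaves the negative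
  squares \<open>- a j / (1 - a j) \<bar>z\<^sub>j q\<bar>\<^sup>2\<close>, against which stands the form \<open>\<parallel>z\<parallel>\<^sup>4 A\<close>, diagonal in the cubic
  monomials. The cubics \<open>z\<^sub>j q\<close> for different \<open>j\<close> have no monomial in common, so the question splits
  into one Cauchy-Schwarz inequality for each \<open>j\<close> (\<open>cubic_form_sos\<close>). These inequalities hold for
  weights that are a small multiple of \<open>\<alpha> j = sqrt (1 - (\<sigma> j)\<^sup>2)\<close>, and this is where the hypothesis
  \<open>\<Sum>j. \<alpha> j > n - 1\<close> enters (\<open>weights_for_cubic_form\<close>).

  The remaining properties are read off the identity for \<open>\<parallel>P\<parallel>\<^sup>2\<close>. On the closed ball \<open>g\<close> has no zero
  because \<open>\<bar>q\<bar> < 1\<close> there, so \<open>P / g\<close> is holomorphic; at the origin \<open>P\<close> vanishes, and inside the ball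
  \<open>\<parallel>P\<parallel> < \<bar>g\<bar>\<close>. A nonconstant common factor of \<open>g\<close> and \<open>P\<close> would have a zero
  (\<open>nonconstant_cpoly_has_zero\<close>); there \<open>g = 0\<close>, hence \<open>\<parallel>z\<parallel> > 1\<close> and
  \<open>\<parallel>P\<parallel>\<^sup>2 = (\<parallel>z\<parallel>\<^sup>4 - 1) A > 0\<close>, a contradiction. Finally, \<open>\<parallel>P\<parallel>\<^sup>2\<close> grows like the sixth power of \<open>\<parallel>z\<parallel>\<close>
  on the coordinate axes, so some component of \<open>P\<close> has degree three.
\<close>

section \<open>Evaluation and degree of polynomials in several variables\<close>

lemma cpoly_as_sum_of_terms:
  fixes p :: "'n cpoly"
  shows "p = (\<Sum>m\<in>Poly_Mapping.keys p. Poly_Mapping.single m (Poly_Mapping.lookup p m))"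
proof (rule poly_mapping_eqI)
  fix k
  show "Poly_Mapping.lookup p k =
    Poly_Mapping.lookup (\<Sum>m\<in>Poly_Mapping.keys p. Poly_Mapping.single m (Poly_Mapping.lookup p m)) k"
    by (auto simp: lookup_sum lookup_single when_def in_keys_iff)
qed

lemma cpoly_eval_single:
  "cpoly_eval (Poly_Mapping.single m c) z = c * (\<Prod>i\<in>UNIV. (z $ i) ^ Poly_Mapping.lookup m i)"
  by (cases "c = 0") (simp_all add: cpoly_eval_def)

lemma cpoly_eval_0 [simp]: "cpoly_eval 0 z = 0"
  by (simp add: cpoly_eval_def)

lemma cpoly_eval_const [simp]: "cpoly_eval (cpoly_const c) z = c"
  by (simp add: cpoly_const_def cpoly_eval_single)

lemma cpoly_eval_1 [simp]: "cpoly_eval 1 z = 1"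
  using cpoly_eval_const[of 1 z] by (simp add: cpoly_const_def)

lemma cpoly_eval_var [simp]: "cpoly_eval (cpoly_var i) z = z $ i"
proof -
  have "(\<Prod>j\<in>UNIV. (z $ j) ^ Poly_Mapping.lookup (Poly_Mapping.single i 1) j)
      = (\<Prod>j\<in>UNIV. if j = i then z $ j else 1)"
    by (rule prod.cong) (auto simp: lookup_single when_def)
  then show ?thesis
    by (simp add: cpoly_var_def cpoly_eval_single)
qed

lemma cpoly_eval_add [simp]: "cpoly_eval (p + q) z = cpoly_eval p z + cpoly_eval q z"
  unfolding cpoly_eval_def
  by (rule setsum_keys_plus_distrib) (simp_all add: algebra_simps)

lemma cpoly_eval_sum [simp]: "cpoly_eval (sum p I) z = (\<Sum>i\<in>I. cpoly_eval (p i) z)"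
  by (induction I rule: infinite_finite_induct) simp_all

lemma cpoly_eval_mult [simp]: "cpoly_eval (p * q) z = cpoly_eval p z * cpoly_eval q z"
proof -
  let ?term = "\<lambda>p m. Poly_Mapping.single m (Poly_Mapping.lookup p m)"
  have "p * q = (\<Sum>m\<in>Poly_Mapping.keys p. ?term p m) * (\<Sum>m\<in>Poly_Mapping.keys q. ?term q m)"
    using cpoly_as_sum_of_terms[of p] cpoly_as_sum_of_terms[of q] by simp
  also have "cpoly_eval \<dots> z =
      (\<Sum>m\<in>Poly_Mapping.keys p. \<Sum>l\<in>Poly_Mapping.keys q.
        cpoly_eval (?term p m) z * cpoly_eval (?term q l) z)"
    by (simp add: sum_product mult_single cpoly_eval_single lookup_add power_add prod.distrib
        algebra_simps)
  also have "\<dots> = (\<Sum>m\<in>Poly_Mapping.keys p. cpoly_eval (?term p m) z)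
                * (\<Sum>m\<in>Poly_Mapping.keys q. cpoly_eval (?term q m) z)"
    by (simp add: sum_product)
  also have "\<dots> = cpoly_eval p z * cpoly_eval q z"
    by (simp add: cpoly_eval_single) (simp add: cpoly_eval_def)
  finally show ?thesis .
qed

lemma cpoly_eval_power [simp]: "cpoly_eval (p ^ k) z = cpoly_eval p z ^ k"
  by (induction k) simp_all

lemma cpoly_degree_le_iff:
  "cpoly_degree p \<le> d \<longleftrightarrow>
    (\<forall>m\<in>Poly_Mapping.keys p. (\<Sum>i\<in>UNIV. Poly_Mapping.lookup m i) \<le> d)"
  by (auto simp: cpoly_degree_def)

lemma monomial_degree_le:
  "m \<in> Poly_Mapping.keys p \<Longrightarrow> (\<Sum>i\<in>UNIV. Poly_Mapping.lookup m i) \<le> cpoly_degree p"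
  using cpoly_degree_le_iff by blast

lemma cpoly_degree_const [simp]: "cpoly_degree (cpoly_const c) = 0"
  by (cases "c = 0") (simp_all add: cpoly_degree_def cpoly_const_def)

lemma cpoly_degree_1 [simp]: "cpoly_degree 1 = 0"
  by (simp add: cpoly_degree_def)

lemma cpoly_degree_var [simp]: "cpoly_degree (cpoly_var i) = 1"
proof -
  have "(\<Sum>j\<in>UNIV. Poly_Mapping.lookup (Poly_Mapping.single i (1::nat)) j)
      = (\<Sum>j\<in>UNIV. if j = i then 1 else 0)"
    by (rule sum.cong) (auto simp: lookup_single when_def)
  then show ?thesis
    by (simp add: cpoly_degree_def cpoly_var_def)
qed

lemma cpoly_degree_add_le:
  assumes "cpoly_degree p \<le> d" "cpoly_degree q \<le> d"
  shows "cpoly_degree (p + q) \<le> d"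
  using assms keys_add[of p q] unfolding cpoly_degree_le_iff by blast

lemma cpoly_degree_sum_le:
  assumes "\<And>i. i \<in> I \<Longrightarrow> cpoly_degree (p i) \<le> d"
  shows "cpoly_degree (sum p I) \<le> d"
  using assms
proof (induction I rule: infinite_finite_induct)
  case (insert i I)
  then show ?case by (simp add: cpoly_degree_add_le)
qed (simp_all add: cpoly_degree_def)

lemma cpoly_degree_mult_le:
  assumes "cpoly_degree p \<le> d" "cpoly_degree q \<le> e"
  shows "cpoly_degree (p * q) \<le> d + e"
proof -
  have "(\<Sum>i\<in>UNIV. Poly_Mapping.lookup m i) \<le> d + e" if m: "m \<in> Poly_Mapping.keys (p * q)" for m
  proof -
    obtain a b where ab: "m = a + b" "a \<in> Poly_Mapping.keys p" "b \<in> Poly_Mapping.keys q"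
      using m keys_mult[of p q] by blast
    then show ?thesis
      using assms unfolding cpoly_degree_le_iff
      by (auto simp: lookup_add sum.distrib intro!: add_mono)
  qed
  then show ?thesis unfolding cpoly_degree_le_iff by blast
qed

lemma cpoly_degree_power_le:
  assumes "cpoly_degree p \<le> d"
  shows "cpoly_degree (p ^ k) \<le> k * d"
proof (induction k)
  case 0
  show ?case by simp
next
  case (Suc k)
  then show ?case using cpoly_degree_mult_le[OF assms Suc] by simp
qed

text \<open>
  Restricting to \<open>norm z \<ge> 1\<close> lets the monomials of lower degree be absorbed into the top power.
\<close>
lemma cpoly_growth_bound:
  fixes p :: "'n::finite cpoly"
  shows "\<exists>C\<ge>0. \<forall>z. 1 \<le> norm z \<longrightarrow> cmod (cpoly_eval p z) \<le> C * norm z ^ cpoly_degree p"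
proof (intro exI conjI allI impI)
  let ?C = "\<Sum>m\<in>Poly_Mapping.keys p. cmod (Poly_Mapping.lookup p m)"
  show "0 \<le> ?C" by (simp add: sum_nonneg)
  fix z :: "complex ^ 'n" assume z: "1 \<le> norm z"
  have "cmod (cpoly_eval p z) \<le> (\<Sum>m\<in>Poly_Mapping.keys p.
      cmod (Poly_Mapping.lookup p m * (\<Prod>i\<in>UNIV. (z $ i) ^ Poly_Mapping.lookup m i)))"
    unfolding cpoly_eval_def by (rule norm_sum)
  also have "\<dots> \<le> (\<Sum>m\<in>Poly_Mapping.keys p.
      cmod (Poly_Mapping.lookup p m) * norm z ^ cpoly_degree p)"
  proof (rule sum_mono)
    fix m assume m: "m \<in> Poly_Mapping.keys p"
    have "cmod (\<Prod>i\<in>UNIV. (z $ i) ^ Poly_Mapping.lookup m i)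
        = (\<Prod>i\<in>UNIV. cmod (z $ i) ^ Poly_Mapping.lookup m i)"
      by (simp add: norm_power flip: prod_norm)
    also have "\<dots> \<le> (\<Prod>i\<in>UNIV. norm z ^ Poly_Mapping.lookup m i)"
      by (intro prod_mono conjI power_mono Finite_Cartesian_Product.norm_nth_le) auto
    also have "\<dots> = norm z ^ (\<Sum>i\<in>UNIV. Poly_Mapping.lookup m i)"
      by (simp add: power_sum)
    also have "\<dots> \<le> norm z ^ cpoly_degree p"
      using z monomial_degree_le[OF m] by (rule power_increasing[rotated])
    finally show "cmod (Poly_Mapping.lookup p m * (\<Prod>i\<in>UNIV. (z $ i) ^ Poly_Mapping.lookup m i))
        \<le> cmod (Poly_Mapping.lookup p m) * norm z ^ cpoly_degree p"
      by (simp add: norm_mult mult_left_mono)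
  qed
  also have "\<dots> = ?C * norm z ^ cpoly_degree p"
    by (simp add: sum_distrib_right)
  finally show "cmod (cpoly_eval p z) \<le> ?C * norm z ^ cpoly_degree p" .
qed

text \<open>
  The weights are taken on the moment curve, \<open>w i = s ^ e i\<close> with distinct exponents \<open>e i\<close>.
  Two different exponent vectors \<open>m\<close>, \<open>l\<close> get equal weight only when \<open>s\<close> is a root of the nonzero
  polynomial \<open>\<Sum>i. (m i - l i) x ^ e i\<close>, and finitely many pairs exclude only finitely many \<open>s\<close>.
\<close>
lemma ex_separating_weights:
  fixes M :: "('n::finite \<Rightarrow>\<^sub>0 nat) set"
  assumes "finite M"
  shows "\<exists>w :: 'n \<Rightarrow> nat. (\<forall>i. w i > 0) \<and>
    inj_on (\<lambda>m. \<Sum>i\<in>UNIV. w i * Poly_Mapping.lookup m i) M"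
proof -
  obtain e :: "'n \<Rightarrow> nat" where e: "inj e"
    using finite_imp_inj_to_nat_seg[of "UNIV :: 'n set"] by auto
  define D :: "('n \<Rightarrow>\<^sub>0 nat) \<Rightarrow> ('n \<Rightarrow>\<^sub>0 nat) \<Rightarrow> int poly" where
    "D m l = (\<Sum>i\<in>UNIV. monom (int (Poly_Mapping.lookup m i) - int (Poly_Mapping.lookup l i)) (e i))"
    for m l
  have D_nz: "D m l \<noteq> 0" if ml: "m \<noteq> l" for m l
  proof -
    obtain i where i: "Poly_Mapping.lookup m i \<noteq> Poly_Mapping.lookup l i"
      using poly_mapping_eqI[of m l] ml by blast
    have "coeff (D m l) (e i) =
        (\<Sum>j\<in>UNIV. if j = i then int (Poly_Mapping.lookup m i) - int (Poly_Mapping.lookup l i) else 0)"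
      unfolding D_def coeff_sum using e by (intro sum.cong) (auto simp: inj_eq)
    also have "\<dots> \<noteq> 0" using i by simp
    finally show ?thesis by force
  qed
  define R where "R = (\<Union>(m, l)\<in>{(m, l) \<in> M \<times> M. m \<noteq> l}. {x. poly (D m l) x = 0})"
  have "finite {(m, l) \<in> M \<times> M. m \<noteq> l}"
    by (rule finite_subset[of _ "M \<times> M"]) (auto simp: assms)
  then have "finite R"
    unfolding R_def by (rule finite_UN_I) (auto simp: D_nz intro!: poly_roots_finite)
  moreover have "infinite (int ` {1..})"
    using infinite_Ici[of "1::nat"] by (subst finite_image_iff) auto
  ultimately have "\<not> int ` {1..} \<subseteq> R"
    using finite_subset by blast
  then obtain s :: nat where s: "s \<ge> 1" "int s \<notin> R"
    by auto
  have "inj_on (\<lambda>m. \<Sum>i\<in>UNIV. s ^ e i * Poly_Mapping.lookup m i) M"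
  proof (rule inj_onI, rule ccontr)
    fix m l assume ml: "m \<in> M" "l \<in> M" "m \<noteq> l"
      "(\<Sum>i\<in>UNIV. s ^ e i * Poly_Mapping.lookup m i) = (\<Sum>i\<in>UNIV. s ^ e i * Poly_Mapping.lookup l i)"
    have "poly (D m l) (int s) = int (\<Sum>i\<in>UNIV. s ^ e i * Poly_Mapping.lookup m i)
        - int (\<Sum>i\<in>UNIV. s ^ e i * Poly_Mapping.lookup l i)"
      by (simp add: D_def poly_sum poly_monom left_diff_distrib right_diff_distrib
          sum_subtractf mult.commute)
    also have "\<dots> = 0" using ml(4) by simp
    finally have "int s \<in> R" using ml(1-3) unfolding R_def by (intro UN_I[of "(m, l)"]) simp_all
    then show False using s(2) by simp
  qed
  moreover have "\<forall>i. s ^ e i > 0"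
    using s(1) by simp
  ultimately show ?thesis
    by (intro exI[of _ "\<lambda>i. s ^ e i"] conjI)
qed

text \<open>
  Along a curve \<open>z i = t ^ w i\<close> with separating weights, distinct monomials become distinct
  powers of \<open>t\<close>. Nothing cancels, so the restriction is a nonconstant polynomial in one variable
  and has a complex root.
\<close>
lemma nonconstant_cpoly_has_zero:
  fixes h :: "'n::finite cpoly"
  assumes "cpoly_degree h \<noteq> 0"
  shows "\<exists>z. cpoly_eval h z = 0"
proof -
  obtain w :: "'n \<Rightarrow> nat" where w: "\<And>i. w i > 0"
    "inj_on (\<lambda>m. \<Sum>i\<in>UNIV. w i * Poly_Mapping.lookup m i) (Poly_Mapping.keys h)"
    using ex_separating_weights[of "Poly_Mapping.keys h"] by auto
  define W where "W m = (\<Sum>i\<in>UNIV. w i * Poly_Mapping.lookup m i)" for m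
  define u where "u = (\<Sum>m\<in>Poly_Mapping.keys h. monom (Poly_Mapping.lookup h m) (W m))"
  have u_eval: "poly u t = cpoly_eval h (\<chi> i. t ^ w i)" for t
    by (simp add: u_def cpoly_eval_def poly_sum poly_monom W_def power_sum power_mult)
  obtain m where m: "m \<in> Poly_Mapping.keys h" "(\<Sum>i\<in>UNIV. Poly_Mapping.lookup m i) > 0"
    using assms cpoly_degree_le_iff[of h 0] by (metis le_0_eq neq0_conv)
  have "W m \<ge> (\<Sum>i\<in>UNIV. Poly_Mapping.lookup m i)"
    unfolding W_def using w(1) by (intro sum_mono) (simp add: Suc_leI)
  then have "W m > 0" using m(2) by simp
  have "coeff u (W m) = (\<Sum>l\<in>Poly_Mapping.keys h. if l = m then Poly_Mapping.lookup h m else 0)"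
    unfolding u_def coeff_sum
    using w(2) m(1) by (intro sum.cong) (auto simp: W_def dest: inj_onD)
  also have "\<dots> = Poly_Mapping.lookup h m" using m(1) by simp
  finally have "coeff u (W m) \<noteq> 0" using m(1) by (simp add: in_keys_iff)
  then have "W m \<le> degree u" by (rule le_degree)
  with \<open>W m > 0\<close> have "\<not> constant (poly u)" by (simp add: constant_degree)
  then show ?thesis
    using fundamental_theorem_of_algebra u_eval by metis
qed

section \<open>Holomorphy in several variables\<close>

lemma holomorphic_multi_on_const: "holomorphic_multi_on (\<lambda>z. c) S"
  unfolding holomorphic_multi_on_def
  by (auto intro!: exI[of _ "\<lambda>v. 0"])

lemma holomorphic_multi_on_coord: "holomorphic_multi_on (\<lambda>z. z $ i) S"
  unfolding holomorphic_multi_on_def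
  by (auto intro!: exI[of _ "\<lambda>v. v $ i"] bounded_linear_imp_has_derivative bounded_linear_vec_nth)

lemma holomorphic_multi_on_add:
  assumes "holomorphic_multi_on f S" "holomorphic_multi_on g S"
  shows "holomorphic_multi_on (\<lambda>z. f z + g z) S"
  unfolding holomorphic_multi_on_def
proof
  fix z assume "z \<in> S"
  then obtain L K where L: "(f has_derivative L) (at z)" "\<And>c v. L (c *s v) = c * L v"
    and K: "(g has_derivative K) (at z)" "\<And>c v. K (c *s v) = c * K v"
    using assms unfolding holomorphic_multi_on_def by meson
  have "((\<lambda>z. f z + g z) has_derivative (\<lambda>v. L v + K v)) (at z)"
    by (rule has_derivative_add[OF L(1) K(1)])
  then show "\<exists>L. ((\<lambda>z. f z + g z) has_derivative L) (at z) \<and> (\<forall>c v. L (c *s v) = c * L v)"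
    by (intro exI conjI allI) (assumption, simp add: L(2) K(2) algebra_simps)
qed

lemma holomorphic_multi_on_mult:
  assumes "holomorphic_multi_on f S" "holomorphic_multi_on g S"
  shows "holomorphic_multi_on (\<lambda>z. f z * g z) S"
  unfolding holomorphic_multi_on_def
proof
  fix z assume "z \<in> S"
  then obtain L K where L: "(f has_derivative L) (at z)" "\<And>c v. L (c *s v) = c * L v"
    and K: "(g has_derivative K) (at z)" "\<And>c v. K (c *s v) = c * K v"
    using assms unfolding holomorphic_multi_on_def by meson
  have "((\<lambda>z. f z * g z) has_derivative (\<lambda>v. f z * K v + L v * g z)) (at z)"
    by (rule has_derivative_mult[OF L(1) K(1)])
  then show "\<exists>L. ((\<lambda>z. f z * g z) has_derivative L) (at z) \<and> (\<forall>c v. L (c *s v) = c * L v)"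
    by (intro exI conjI allI) (assumption, simp add: L(2) K(2) algebra_simps)
qed

lemma holomorphic_multi_on_divide:
  assumes "holomorphic_multi_on f S" "holomorphic_multi_on g S" "\<And>z. z \<in> S \<Longrightarrow> g z \<noteq> 0"
  shows "holomorphic_multi_on (\<lambda>z. f z / g z) S"
  unfolding holomorphic_multi_on_def
proof
  fix z assume "z \<in> S"
  then obtain L K where L: "(f has_derivative L) (at z)" "\<And>c v. L (c *s v) = c * L v"
    and K: "(g has_derivative K) (at z)" "\<And>c v. K (c *s v) = c * K v"
    using assms(1,2) unfolding holomorphic_multi_on_def by meson
  have "((\<lambda>z. f z / g z) has_derivative (\<lambda>v. (L v * g z - f z * K v) / (g z * g z))) (at z)"
    by (rule has_derivative_divide'[OF L(1) K(1) assms(3)[OF \<open>z \<in> S\<close>]])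
  then show "\<exists>L. ((\<lambda>z. f z / g z) has_derivative L) (at z) \<and> (\<forall>c v. L (c *s v) = c * L v)"
    by (intro exI conjI allI) (assumption, simp add: L(2) K(2) algebra_simps diff_divide_distrib)
qed

lemma holomorphic_multi_on_power:
  assumes "holomorphic_multi_on f S"
  shows "holomorphic_multi_on (\<lambda>z. f z ^ k) S"
  by (induction k) (simp_all add: holomorphic_multi_on_const holomorphic_multi_on_mult assms)

lemma holomorphic_multi_on_prod:
  assumes "\<And>i. i \<in> I \<Longrightarrow> holomorphic_multi_on (f i) S"
  shows "holomorphic_multi_on (\<lambda>z. \<Prod>i\<in>I. f i z) S"
  using assms
  by (induction I rule: infinite_finite_induct)
    (simp_all add: holomorphic_multi_on_const holomorphic_multi_on_mult)

lemma holomorphic_multi_on_sum: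
  assumes "\<And>i. i \<in> I \<Longrightarrow> holomorphic_multi_on (f i) S"
  shows "holomorphic_multi_on (\<lambda>z. \<Sum>i\<in>I. f i z) S"
  using assms
  by (induction I rule: infinite_finite_induct)
    (simp_all add: holomorphic_multi_on_const holomorphic_multi_on_add)

lemma holomorphic_multi_on_cpoly_eval: "holomorphic_multi_on (cpoly_eval p) S"
  unfolding cpoly_eval_def [abs_def]
  by (intro holomorphic_multi_on_sum holomorphic_multi_on_mult holomorphic_multi_on_const
      holomorphic_multi_on_prod holomorphic_multi_on_power holomorphic_multi_on_coord)

section \<open>Hermitian sums of squares\<close>

text \<open>
  These are the functions \<open>\<parallel>P\<parallel>\<^sup>2\<close> for polynomial maps \<open>P\<close> of degree at most \<open>d\<close> into some \<open>\<complex>\<^sup>N\<close>.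
  The target dimension is existentially quantified, so that the class is closed under addition
  and the components of \<open>P\<close> need not be numbered by hand.
\<close>
definition hermitian_sos :: "nat \<Rightarrow> (complex ^ 'n::finite \<Rightarrow> real) \<Rightarrow> bool" where
  "hermitian_sos d H \<longleftrightarrow> (\<exists>N (P :: nat \<Rightarrow> 'n cpoly). (\<forall>k<N. cpoly_degree (P k) \<le> d) \<and>
     (\<forall>z. H z = (\<Sum>k<N. (cmod (cpoly_eval (P k) z))\<^sup>2)))"

lemma hermitian_sos_add:
  assumes "hermitian_sos d G" "hermitian_sos d H"
  shows "hermitian_sos d (\<lambda>z. G z + H z)"
proof -
  obtain N :: nat and P where P: "\<And>k. k < N \<Longrightarrow> cpoly_degree (P k) \<le> d"
    "\<And>z. G z = (\<Sum>k<N. (cmod (cpoly_eval (P k) z))\<^sup>2)"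
    using assms(1) by (auto simp: hermitian_sos_def)
  obtain M :: nat and Q where Q: "\<And>k. k < M \<Longrightarrow> cpoly_degree (Q k) \<le> d"
    "\<And>z. H z = (\<Sum>k<M. (cmod (cpoly_eval (Q k) z))\<^sup>2)"
    using assms(2) by (auto simp: hermitian_sos_def)
  have split: "(\<Sum>k<N + M. f k) = (\<Sum>k<N. f k) + (\<Sum>k<M. f (N + k))" for f :: "nat \<Rightarrow> real"
    by (induction M) simp_all
  show ?thesis
    unfolding hermitian_sos_def
    by (rule exI[of _ "N + M"], rule exI[of _ "\<lambda>k. if k < N then P k else Q (k - N)"])
      (auto simp: split P Q)
qed

lemma hermitian_sos_scaled_square:
  assumes "0 \<le> c" "cpoly_degree p \<le> d"
  shows "hermitian_sos d (\<lambda>z. c * (cmod (cpoly_eval p z))\<^sup>2)"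
  unfolding hermitian_sos_def
proof (intro exI conjI allI impI)
  fix k :: nat and z
  show "cpoly_degree (cpoly_const (complex_of_real (sqrt c)) * p) \<le> d"
    using cpoly_degree_mult_le[OF _ assms(2), of _ 0] by simp
  show "c * (cmod (cpoly_eval p z))\<^sup>2 =
      (\<Sum>k<1::nat. (cmod (cpoly_eval (cpoly_const (complex_of_real (sqrt c)) * p) z))\<^sup>2)"
    using assms(1) by (simp add: norm_mult power_mult_distrib)
qed

lemma hermitian_sos_sum:
  assumes "\<And>i. i \<in> I \<Longrightarrow> hermitian_sos d (H i)"
  shows "hermitian_sos d (\<lambda>z. \<Sum>i\<in>I. H i z)"
  using assms
proof (induction I rule: infinite_finite_induct)
  case (insert i I)
  then show ?case by (simp add: hermitian_sos_add)
qed (use hermitian_sos_scaled_square[of 0 0 d] in \<open>simp_all add: cpoly_degree_def\<close>)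

text \<open>
  The right-hand side is twice the defect in the Cauchy-Schwarz inequality for the vectors
  \<open>s i / sqrt (d i)\<close> and \<open>sqrt (d i) * u i\<close>. Writing it as a sum of squares of linear forms in \<open>u\<close>
  is what turns the inequality into a decomposition.
\<close>
lemma weighted_lagrange_identity:
  fixes s d u :: "'a \<Rightarrow> real"
  assumes "\<And>i. i \<in> I \<Longrightarrow> d i > 0"
  shows "(\<Sum>i\<in>I. \<Sum>k\<in>I. (s i * d k * u k - s k * d i * u i)\<^sup>2 / (d i * d k)) =
    2 * (\<Sum>i\<in>I. (s i)\<^sup>2 / d i) * (\<Sum>i\<in>I. d i * (u i)\<^sup>2) - 2 * (\<Sum>i\<in>I. s i * u i)\<^sup>2"
proof -
  have "(s i * d k * u k - s k * d i * u i)\<^sup>2 / (d i * d k) =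
      ((s i)\<^sup>2 / d i) * (d k * (u k)\<^sup>2) + (d i * (u i)\<^sup>2) * ((s k)\<^sup>2 / d k)
      - 2 * ((s i * u i) * (s k * u k))" if "i \<in> I" "k \<in> I" for i k
    using assms[OF that(1)] assms[OF that(2)] by (simp add: field_simps power2_eq_square)
  then have "(\<Sum>i\<in>I. \<Sum>k\<in>I. (s i * d k * u k - s k * d i * u i)\<^sup>2 / (d i * d k)) =
      (\<Sum>i\<in>I. \<Sum>k\<in>I. ((s i)\<^sup>2 / d i) * (d k * (u k)\<^sup>2) + (d i * (u i)\<^sup>2) * ((s k)\<^sup>2 / d k)
      - 2 * ((s i * u i) * (s k * u k)))"
    by simp
  also have "\<dots> = (\<Sum>i\<in>I. (s i)\<^sup>2 / d i) * (\<Sum>i\<in>I. d i * (u i)\<^sup>2)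
      + (\<Sum>i\<in>I. d i * (u i)\<^sup>2) * (\<Sum>i\<in>I. (s i)\<^sup>2 / d i)
      - 2 * ((\<Sum>i\<in>I. s i * u i) * (\<Sum>i\<in>I. s i * u i))"
    by (simp only: sum.distrib sum_subtractf sum_product sum_distrib_left[of "2 :: real", symmetric])
  finally show ?thesis by (simp add: power2_eq_square)
qed

lemma complex_weighted_lagrange_identity:
  fixes s d :: "'a \<Rightarrow> real" and w :: "'a \<Rightarrow> complex"
  assumes "\<And>i. i \<in> I \<Longrightarrow> d i > 0"
  shows "(\<Sum>i\<in>I. \<Sum>k\<in>I. (cmod (of_real (s i * d k) * w k - of_real (s k * d i) * w i))\<^sup>2 / (d i * d k)) =
    2 * (\<Sum>i\<in>I. (s i)\<^sup>2 / d i) * (\<Sum>i\<in>I. d i * (cmod (w i))\<^sup>2) - 2 * (cmod (\<Sum>i\<in>I. of_real (s i) * w i))\<^sup>2"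
  using weighted_lagrange_identity[of I d s "\<lambda>i. Re (w i)", OF assms]
    weighted_lagrange_identity[of I d s "\<lambda>i. Im (w i)", OF assms]
  by (simp add: cmod_power2 add_divide_distrib sum.distrib distrib_left)

text \<open>
  A diagonal form minus a rank-one form, \<open>D - b v v\<^sup>*\<close>, is positive semidefinite when
  \<open>b v\<^sup>* D\<^sup>-\<^sup>1 v \<le> 1\<close>. The squares are explicit: a multiple \<open>1 - b S\<close> of the diagonal form is left over,
  and the rest is the Lagrange identity.
\<close>
lemma diagonal_minus_rank_one_sos:
  fixes w :: "'i \<Rightarrow> 'n::finite cpoly"
  assumes d: "\<And>i. i \<in> I \<Longrightarrow> d i > 0" and b: "b \<ge> 0"
    and small: "b * (\<Sum>i\<in>I. (s i)\<^sup>2 / d i) \<le> 1"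
    and deg: "\<And>i. i \<in> I \<Longrightarrow> cpoly_degree (w i) \<le> D"
  shows "hermitian_sos D (\<lambda>z. (\<Sum>i\<in>I. d i * (cmod (cpoly_eval (w i) z))\<^sup>2)
           - b * (cmod (\<Sum>i\<in>I. of_real (s i) * cpoly_eval (w i) z))\<^sup>2)"
proof -
  define S where "S = (\<Sum>i\<in>I. (s i)\<^sup>2 / d i)"
  define m where "m i k = cpoly_const (of_real (s i * d k)) * w k
      + cpoly_const (- of_real (s k * d i)) * w i" for i k
  have deg_m: "cpoly_degree (m i k) \<le> D" if "i \<in> I" "k \<in> I" for i k
    unfolding m_def
    using cpoly_degree_mult_le[OF _ deg[OF that(1)], of _ 0]
      cpoly_degree_mult_le[OF _ deg[OF that(2)], of _ 0]
    by (intro cpoly_degree_add_le) simp_all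
  have "hermitian_sos D (\<lambda>z. (\<Sum>i\<in>I. ((1 - b * S) * d i) * (cmod (cpoly_eval (w i) z))\<^sup>2)
      + (\<Sum>i\<in>I. \<Sum>k\<in>I. (b / (2 * (d i * d k))) * (cmod (cpoly_eval (m i k) z))\<^sup>2))"
  proof (intro hermitian_sos_add hermitian_sos_sum hermitian_sos_scaled_square deg deg_m)
    fix i assume "i \<in> I"
    then show "0 \<le> (1 - b * S) * d i"
      using d small by (simp add: S_def less_imp_le)
  next
    fix i k assume "i \<in> I" "k \<in> I"
    then show "0 \<le> b / (2 * (d i * d k))"
      using d b by (simp add: less_imp_le)
  qed
  moreover have "(\<Sum>i\<in>I. ((1 - b * S) * d i) * (cmod (cpoly_eval (w i) z))\<^sup>2)
      + (\<Sum>i\<in>I. \<Sum>k\<in>I. (b / (2 * (d i * d k))) * (cmod (cpoly_eval (m i k) z))\<^sup>2)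
      = (\<Sum>i\<in>I. d i * (cmod (cpoly_eval (w i) z))\<^sup>2)
           - b * (cmod (\<Sum>i\<in>I. of_real (s i) * cpoly_eval (w i) z))\<^sup>2" for z
  proof -
    let ?W = "\<Sum>i\<in>I. d i * (cmod (cpoly_eval (w i) z))\<^sup>2"
    have "(\<Sum>i\<in>I. \<Sum>k\<in>I. (b / (2 * (d i * d k))) * (cmod (cpoly_eval (m i k) z))\<^sup>2) =
        b / 2 * (\<Sum>i\<in>I. \<Sum>k\<in>I. (cmod (of_real (s i * d k) * cpoly_eval (w k) z
          - of_real (s k * d i) * cpoly_eval (w i) z))\<^sup>2 / (d i * d k))"
      by (simp add: m_def sum_distrib_left)
    also have "\<dots> = b / 2 * (2 * S * ?W - 2 * (cmod (\<Sum>i\<in>I. of_real (s i) * cpoly_eval (w i) z))\<^sup>2)"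
      using complex_weighted_lagrange_identity[of I d s "\<lambda>i. cpoly_eval (w i) z", OF d]
      unfolding S_def by simp
    moreover have "(\<Sum>i\<in>I. ((1 - b * S) * d i) * (cmod (cpoly_eval (w i) z))\<^sup>2) = (1 - b * S) * ?W"
      by (simp add: sum_distrib_left mult.assoc)
    ultimately show ?thesis
      by (simp only:) (simp add: algebra_simps)
  qed
  ultimately show ?thesis by simp
qed

section \<open>The cubic Hermitian form\<close>

lemma norm_power2_eq_sum: "(norm (z :: complex ^ 'n::finite))\<^sup>2 = (\<Sum>i\<in>UNIV. (cmod (z $ i))\<^sup>2)"
  by (simp add: norm_vec_def L2_set_def sum_nonneg)

text \<open>
  For \<open>x i = (cmod (z $ i))\<^sup>2\<close> this expresses \<open>(norm z)^4 * (\<Sum>j. a j * (cmod (z $ j))\<^sup>2)\<close> by squared moduli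
  of cubic monomials. The first sum collects the monomials \<open>z\<^sub>j z\<^sub>i\<^sup>2\<close>, which are those that occur in
  \<open>z\<^sub>j \<Sum>i. \<sigma> i z\<^sub>i\<^sup>2\<close>. Each of them is counted for a single \<open>j\<close>, the index with odd exponent, so the
  monomials that belong to different \<open>j\<close> do not interact.
\<close>
lemma cubic_monomial_expansion:
  fixes a x :: "'n::finite \<Rightarrow> real"
  shows "(\<Sum>i\<in>UNIV. x i)\<^sup>2 * (\<Sum>j\<in>UNIV. a j * x j) =
    (\<Sum>j\<in>UNIV. \<Sum>i\<in>UNIV. (a j + (if i = j then 0 else 2 * a i)) * (x j * (x i)\<^sup>2)) +
    (\<Sum>i\<in>UNIV. \<Sum>j\<in>UNIV. \<Sum>k\<in>UNIV.
      (if i \<noteq> j \<and> j \<noteq> k \<and> i \<noteq> k then a j else 0) * (x i * x j * x k))"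
proof -
  let ?T = "\<lambda>i j k. a j * (x i * x j * x k)"
  have "(\<Sum>i\<in>UNIV. x i)\<^sup>2 * (\<Sum>j\<in>UNIV. a j * x j) = (\<Sum>i\<in>UNIV. \<Sum>j\<in>UNIV. \<Sum>k\<in>UNIV. ?T i j k)"
  proof -
    have "(\<Sum>i\<in>UNIV. x i)\<^sup>2 * (\<Sum>j\<in>UNIV. a j * x j)
        = (\<Sum>i\<in>UNIV. x i) * ((\<Sum>j\<in>UNIV. a j * x j) * (\<Sum>k\<in>UNIV. x k))"
      by (simp add: power2_eq_square)
    also have "\<dots> = (\<Sum>i\<in>UNIV. \<Sum>j\<in>UNIV. \<Sum>k\<in>UNIV. x i * (a j * x j * x k))"
      unfolding sum_product unfolding sum_distrib_left ..
    finally show ?thesis by (simp add: mult_ac)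
  qed
  \<comment> \<open>The cases \<open>k = i\<close>, \<open>i = j \<noteq> k\<close>, \<open>k = j \<noteq> i\<close> and all distinct exclude each other and cover everything.\<close>
  also have "\<dots> = (\<Sum>i\<in>UNIV. \<Sum>j\<in>UNIV. \<Sum>k\<in>UNIV.
      (if k = i then ?T i j i else 0) + (if i = j \<and> k \<noteq> j then ?T j j k else 0)
      + (if k = j \<and> i \<noteq> j then ?T i j j else 0)
      + (if i \<noteq> j \<and> j \<noteq> k \<and> i \<noteq> k then a j else 0) * (x i * x j * x k))"
    by (intro sum.cong refl) auto
  also have "\<dots> = (\<Sum>i\<in>UNIV. \<Sum>j\<in>UNIV. ?T i j i)
      + (\<Sum>i\<in>UNIV. \<Sum>j\<in>UNIV. \<Sum>k\<in>UNIV. if i = j \<and> k \<noteq> j then ?T j j k else 0)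
      + (\<Sum>i\<in>UNIV. \<Sum>j\<in>UNIV. \<Sum>k\<in>UNIV. if k = j \<and> i \<noteq> j then ?T i j j else 0)
      + (\<Sum>i\<in>UNIV. \<Sum>j\<in>UNIV. \<Sum>k\<in>UNIV.
          (if i \<noteq> j \<and> j \<noteq> k \<and> i \<noteq> k then a j else 0) * (x i * x j * x k))"
    by (simp add: sum.distrib)
  also have "(\<Sum>i\<in>UNIV. \<Sum>j\<in>UNIV. \<Sum>k\<in>UNIV. if i = j \<and> k \<noteq> j then ?T j j k else 0)
      = (\<Sum>i\<in>UNIV. \<Sum>k\<in>UNIV. if k \<noteq> i then ?T i i k else 0)"
  proof (rule sum.cong[OF refl])
    fix i
    have "(\<Sum>j\<in>UNIV. \<Sum>k\<in>UNIV. if i = j \<and> k \<noteq> j then ?T j j k else 0)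
        = (\<Sum>j\<in>UNIV. if i = j then (\<Sum>k\<in>UNIV. if k \<noteq> i then ?T i i k else 0) else 0)"
      by (intro sum.cong refl) auto
    then show "(\<Sum>j\<in>UNIV. \<Sum>k\<in>UNIV. if i = j \<and> k \<noteq> j then ?T j j k else 0)
        = (\<Sum>k\<in>UNIV. if k \<noteq> i then ?T i i k else 0)"
      by simp
  qed
  also have "(\<Sum>i\<in>UNIV. \<Sum>j\<in>UNIV. \<Sum>k\<in>UNIV. if k = j \<and> i \<noteq> j then ?T i j j else 0)
      = (\<Sum>i\<in>UNIV. \<Sum>j\<in>UNIV. if i \<noteq> j then ?T i j j else 0)"
  proof (intro sum.cong refl)
    fix i j
    have "(\<Sum>k\<in>UNIV. if k = j \<and> i \<noteq> j then ?T i j j else 0)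
        = (\<Sum>k\<in>UNIV. if k = j then (if i \<noteq> j then ?T i j j else 0) else 0)"
      by (intro sum.cong refl) auto
    then show "(\<Sum>k\<in>UNIV. if k = j \<and> i \<noteq> j then ?T i j j else 0) = (if i \<noteq> j then ?T i j j else 0)"
      by simp
  qed
  also have "(\<Sum>i\<in>UNIV. \<Sum>j\<in>UNIV. ?T i j i) + (\<Sum>i\<in>UNIV. \<Sum>k\<in>UNIV. if k \<noteq> i then ?T i i k else 0)
      + (\<Sum>i\<in>UNIV. \<Sum>j\<in>UNIV. if i \<noteq> j then ?T i j j else 0)
    = (\<Sum>i\<in>UNIV. \<Sum>j\<in>UNIV. (a j + (if i = j then 0 else 2 * a i)) * (x j * (x i)\<^sup>2))"
  proof -
    have swap: "(\<Sum>i\<in>UNIV. \<Sum>j\<in>UNIV. if i \<noteq> j then ?T i j j else 0)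
        = (\<Sum>i\<in>UNIV. \<Sum>j\<in>UNIV. if j \<noteq> i then ?T j i i else 0)"
      by (subst sum.swap) (rule refl)
    show ?thesis
      unfolding swap unfolding sum.distrib[symmetric]
      by (intro sum.cong refl, auto simp: power2_eq_square algebra_simps)
  qed
  also have "(\<Sum>i\<in>UNIV. \<Sum>j\<in>UNIV. (a j + (if i = j then 0 else 2 * a i)) * (x j * (x i)\<^sup>2))
    = (\<Sum>j\<in>UNIV. \<Sum>i\<in>UNIV. (a j + (if i = j then 0 else 2 * a i)) * (x j * (x i)\<^sup>2))"
    by (rule sum.swap)
  finally show ?thesis .
qed

text \<open>
  For a quadratic form \<open>q\<close> and after multiplication by \<open>(cmod (z $ j))\<^sup>2\<close>, this removes the
  mixed terms of bidegree (3,1) and (1,3), at the price of a negative square of the cubic \<open>z\<^sub>j q\<close>.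
\<close>
lemma completed_square_of_shift:
  fixes q :: complex and a :: real
  assumes "a < 1"
  shows "(cmod (1 + q))\<^sup>2 - a = 1 / (1 - a) * (cmod (of_real (1 - a) + q))\<^sup>2 - a / (1 - a) * (cmod q)\<^sup>2"
proof -
  have "1 - a \<noteq> 0" using assms by simp
  then show ?thesis
    unfolding cmod_power2 by (simp add: divide_simps) (simp add: power2_eq_square algebra_simps)
qed

text \<open>
  Completing the square in each \<open>(cmod (z $ j))\<^sup>2 * ((cmod (1 + q))\<^sup>2 - a j)\<close>, with
  \<open>q = \<Sum>i. \<sigma> i z\<^sub>i\<^sup>2\<close>, leaves the negative squares \<open>- a j / (1 - a j) * (cmod (z\<^sub>j q))\<^sup>2\<close>. They have to
  be absorbed by the diagonal form \<open>norm z ^ 4 * (\<Sum>j. a j * (cmod (z $ j))\<^sup>2)\<close>. This can be done for each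
  \<open>j\<close> separately, and the assumed inequality is the rank-one criterion for that \<open>j\<close>.
\<close>
lemma cubic_form_sos:
  fixes \<sigma> a :: "'n::finite \<Rightarrow> real"
  assumes a: "\<And>j. 0 < a j" "\<And>j. a j < 1"
    and cond: "\<And>j. (\<Sum>i\<in>UNIV. (\<sigma> i)\<^sup>2 * (a j / (a j + (if i = j then 0 else 2 * a i)))) \<le> 1 - a j"
  shows "hermitian_sos 3 (\<lambda>z :: complex ^ 'n.
    (norm z)\<^sup>2 * (cmod (1 + (\<Sum>i\<in>UNIV. of_real (\<sigma> i) * (z $ i)\<^sup>2)))\<^sup>2
    - (1 - norm z ^ 4) * (\<Sum>j\<in>UNIV. a j * (cmod (z $ j))\<^sup>2))"
proof -
  define Q :: "'n cpoly" where "Q = (\<Sum>i\<in>UNIV. cpoly_const (of_real (\<sigma> i)) * (cpoly_var i)\<^sup>2)"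
  define L where "L j = cpoly_var j * (cpoly_const (of_real (1 - a j)) + Q)" for j
  define w where "w j i = cpoly_var j * (cpoly_var i)\<^sup>2" for j i :: 'n
  define v where "v i j k = cpoly_var i * cpoly_var j * cpoly_var k" for i j k :: 'n
  define c where "c j i = a j + (if i = j then 0 else 2 * a i)" for j i
  have c_pos: "c j i > 0" for j i
    using a(1)[of i] a(1)[of j] by (simp add: c_def)
  have deg_sq: "cpoly_degree ((cpoly_var i)\<^sup>2) \<le> 2" for i :: 'n
    using cpoly_degree_power_le[of "cpoly_var i" 1 2] by simp
  have deg_Q: "cpoly_degree Q \<le> 2"
    unfolding Q_def
    by (rule cpoly_degree_sum_le, rule order_trans[OF cpoly_degree_mult_le[of _ 0 _ 2]])
      (simp_all add: deg_sq)
  have deg_L: "cpoly_degree (L j) \<le> 3" for j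
    unfolding L_def
    by (rule order_trans[OF cpoly_degree_mult_le[of _ 1 _ 2]])
      (simp_all add: cpoly_degree_add_le deg_Q)
  have deg_w: "cpoly_degree (w j i) \<le> 3" for j i
    unfolding w_def
    by (rule order_trans[OF cpoly_degree_mult_le[of _ 1 _ 2]]) (simp_all add: deg_sq)
  have deg_v: "cpoly_degree (v i j k) \<le> 3" for i j k
    unfolding v_def
    using cpoly_degree_mult_le[of "cpoly_var i * cpoly_var j" 2 "cpoly_var k" 1]
      cpoly_degree_mult_le[of "cpoly_var i" 1 "cpoly_var j" 1] by simp
  let ?q = "\<lambda>z :: complex ^ 'n. \<Sum>i\<in>UNIV. of_real (\<sigma> i) * (z $ i)\<^sup>2"
  have "hermitian_sos 3 (\<lambda>z.
      (\<Sum>j\<in>UNIV. 1 / (1 - a j) * (cmod (cpoly_eval (L j) z))\<^sup>2)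
      + (\<Sum>j\<in>UNIV. (\<Sum>i\<in>UNIV. c j i * (cmod (cpoly_eval (w j i) z))\<^sup>2)
          - a j / (1 - a j) * (cmod (\<Sum>i\<in>UNIV. of_real (\<sigma> i) * cpoly_eval (w j i) z))\<^sup>2)
      + (\<Sum>i\<in>UNIV. \<Sum>j\<in>UNIV. \<Sum>k\<in>UNIV.
          (if i \<noteq> j \<and> j \<noteq> k \<and> i \<noteq> k then a j else 0) * (cmod (cpoly_eval (v i j k) z))\<^sup>2))"
  proof (intro hermitian_sos_add hermitian_sos_sum diagonal_minus_rank_one_sos
      hermitian_sos_scaled_square deg_L deg_w deg_v c_pos)
    fix j
    show "0 \<le> 1 / (1 - a j)" "0 \<le> a j / (1 - a j)"
      using a[of j] by simp_all
    have "a j / (1 - a j) * (\<Sum>i\<in>UNIV. (\<sigma> i)\<^sup>2 / c j i)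
        = (\<Sum>i\<in>UNIV. (\<sigma> i)\<^sup>2 * (a j / c j i)) / (1 - a j)"
      by (simp add: sum_distrib_left sum_divide_distrib mult_ac)
    also have "\<dots> \<le> 1"
      using cond[of j] a(2)[of j] by (simp add: c_def)
    finally show "a j / (1 - a j) * (\<Sum>i\<in>UNIV. (\<sigma> i)\<^sup>2 / c j i) \<le> 1" .
  next
    fix i j k
    show "0 \<le> (if i \<noteq> j \<and> j \<noteq> k \<and> i \<noteq> k then a j else 0)"
      using a(1)[of j] by simp
  qed
  moreover have "(\<Sum>j\<in>UNIV. 1 / (1 - a j) * (cmod (cpoly_eval (L j) z))\<^sup>2)
      + (\<Sum>j\<in>UNIV. (\<Sum>i\<in>UNIV. c j i * (cmod (cpoly_eval (w j i) z))\<^sup>2)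
          - a j / (1 - a j) * (cmod (\<Sum>i\<in>UNIV. of_real (\<sigma> i) * cpoly_eval (w j i) z))\<^sup>2)
      + (\<Sum>i\<in>UNIV. \<Sum>j\<in>UNIV. \<Sum>k\<in>UNIV.
          (if i \<noteq> j \<and> j \<noteq> k \<and> i \<noteq> k then a j else 0) * (cmod (cpoly_eval (v i j k) z))\<^sup>2)
    = (norm z)\<^sup>2 * (cmod (1 + ?q z))\<^sup>2 - (1 - norm z ^ 4) * (\<Sum>j\<in>UNIV. a j * (cmod (z $ j))\<^sup>2)" for z
  proof -
    let ?x = "\<lambda>i. (cmod (z $ i))\<^sup>2"
    have L_eval: "1 / (1 - a j) * (cmod (cpoly_eval (L j) z))\<^sup>2
        = ?x j * (cmod (1 + ?q z))\<^sup>2 - a j * ?x j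
          + a j / (1 - a j) * (cmod (\<Sum>i\<in>UNIV. of_real (\<sigma> i) * cpoly_eval (w j i) z))\<^sup>2" for j
    proof -
      have "(\<Sum>i\<in>UNIV. of_real (\<sigma> i) * cpoly_eval (w j i) z) = z $ j * ?q z"
        by (simp add: w_def sum_distrib_left mult_ac)
      moreover have "cpoly_eval (L j) z = z $ j * (of_real (1 - a j) + ?q z)"
        by (simp add: L_def Q_def)
      moreover have "?x j * ((cmod (1 + ?q z))\<^sup>2 - a j) = ?x j * (1 / (1 - a j) * (cmod (of_real (1 - a j) + ?q z))\<^sup>2
          - a j / (1 - a j) * (cmod (?q z))\<^sup>2)"
        using completed_square_of_shift[OF a(2)[of j], of "?q z"] by simp
      ultimately show ?thesis
        by (simp only: norm_mult power_mult_distrib) (simp add: algebra_simps)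
    qed
    have w_eval: "(cmod (cpoly_eval (w j i) z))\<^sup>2 = ?x j * (?x i)\<^sup>2" for j i
      by (simp add: w_def norm_mult norm_power power_mult_distrib)
    have v_eval: "(cmod (cpoly_eval (v i j k) z))\<^sup>2 = ?x i * ?x j * ?x k" for i j k
      by (simp add: v_def norm_mult power_mult_distrib)
    have n4: "norm z ^ 4 = (\<Sum>i\<in>UNIV. ?x i)\<^sup>2"
      by (simp flip: norm_power2_eq_sum)
    show ?thesis
      unfolding L_eval w_eval v_eval c_def n4
      using cubic_monomial_expansion[of ?x a]
      by (simp add: sum.distrib sum_subtractf norm_power2_eq_sum algebra_simps
          flip: sum_distrib_right sum_distrib_left)
  qed
  ultimately show ?thesis by simp
qed

text \<open>
  With \<open>\<alpha> j = sqrt (1 - (\<sigma> j)\<^sup>2)\<close>, the weights are a small multiple of \<open>\<alpha>\<close>. Write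
  \<open>(\<sigma> i)\<^sup>2 = (1 - \<alpha> i) * (1 + \<alpha> i)\<close>. The hypothesis on the sum gives \<open>\<alpha> i + \<alpha> j \<ge> 1\<close> for \<open>i \<noteq> j\<close>, hence
  \<open>1 + \<alpha> i \<le> \<alpha> j + 2 * \<alpha> i\<close>, so the term for \<open>i \<noteq> j\<close> is at most \<open>\<alpha> j * (1 - \<alpha> i)\<close>. Since
  \<open>\<Sum>i. 1 - \<alpha> i = 1 - \<delta>\<close> with \<open>\<delta> > 0\<close>, these terms add up to at most
  \<open>\<alpha> j * (\<alpha> j - \<delta>) = 1 - (\<sigma> j)\<^sup>2 - \<delta> * \<alpha> j\<close>.
\<close>
lemma weights_for_cubic_form:
  fixes \<sigma> :: "'n::finite \<Rightarrow> real"
  assumes \<sigma>: "\<And>j. 0 \<le> \<sigma> j" "\<And>j. \<sigma> j < 1"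
    and sum_gt: "(\<Sum>j\<in>UNIV. sqrt (1 - (\<sigma> j)\<^sup>2)) > real CARD('n) - 1"
  shows "\<exists>a. (\<forall>j. 0 < a j \<and> a j < 1) \<and>
    (\<forall>j. (\<Sum>i\<in>UNIV. (\<sigma> i)\<^sup>2 * (a j / (a j + (if i = j then 0 else 2 * a i)))) \<le> 1 - a j)"
proof -
  define \<alpha> where "\<alpha> j = sqrt (1 - (\<sigma> j)\<^sup>2)" for j
  have \<sigma>2: "(\<sigma> j)\<^sup>2 < 1" for j
    using \<sigma>[of j] by (simp add: power_less_one_iff)
  have \<alpha>: "0 < \<alpha> j" "\<alpha> j \<le> 1" "(\<sigma> j)\<^sup>2 = 1 - (\<alpha> j)\<^sup>2" for j
    using \<sigma>2[of j] by (simp_all add: \<alpha>_def)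
  define \<delta> where "\<delta> = (\<Sum>j\<in>UNIV. \<alpha> j) - (real CARD('n) - 1)"
  have \<delta>_defect: "\<delta> = 1 - (\<Sum>j\<in>UNIV. 1 - \<alpha> j)"
    by (simp add: \<delta>_def sum_subtractf)
  have \<delta>: "0 < \<delta>" "\<delta> \<le> 1"
    using sum_gt \<alpha>(2) by (simp add: \<delta>_def \<alpha>_def) (simp add: \<delta>_defect sum_nonneg \<alpha>(2))
  have pair: "1 \<le> \<alpha> i + \<alpha> j" if "i \<noteq> j" for i j
  proof -
    have "(\<Sum>k\<in>{i, j}. 1 - \<alpha> k) \<le> (\<Sum>k\<in>UNIV. 1 - \<alpha> k)"
      using \<alpha>(2) by (intro sum_mono2) auto
    then show ?thesis using \<delta> that by (simp add: \<delta>_defect)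
  qed
  \<comment> \<open>The factor 1/2 keeps \<open>a j < 1\<close> also when all \<open>\<sigma> j\<close> vanish and \<open>\<delta> = \<alpha> j = 1\<close>.\<close>
  define a where "a j = \<delta> / 2 * \<alpha> j" for j
  have a: "0 < a j" "a j < 1" for j
  proof -
    show "0 < a j" using \<delta> \<alpha> by (simp add: a_def)
    have "\<delta> * \<alpha> j \<le> 1 * 1" using \<delta> \<alpha>[of j] by (intro mult_mono) auto
    then show "a j < 1" by (simp add: a_def)
  qed
  have "(\<Sum>i\<in>UNIV. (\<sigma> i)\<^sup>2 * (a j / (a j + (if i = j then 0 else 2 * a i)))) \<le> 1 - a j" for j
  proof -
    have off_diag: "(\<sigma> i)\<^sup>2 * (a j / (a j + 2 * a i)) \<le> \<alpha> j * (1 - \<alpha> i)" if "i \<noteq> j" for i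
    proof -
      have pos: "\<alpha> j + 2 * \<alpha> i > 0" using \<alpha>[of i] \<alpha>[of j] by simp
      have "a j / (a j + 2 * a i) = (\<delta> / 2 * \<alpha> j) / (\<delta> / 2 * (\<alpha> j + 2 * \<alpha> i))"
        by (simp add: a_def algebra_simps)
      also have "\<dots> = \<alpha> j / (\<alpha> j + 2 * \<alpha> i)"
        using \<delta> by (subst mult_divide_mult_cancel_left) auto
      finally have ratio: "a j / (a j + 2 * a i) = \<alpha> j / (\<alpha> j + 2 * \<alpha> i)" .
      have "(\<sigma> i)\<^sup>2 * (a j / (a j + 2 * a i))
          = \<alpha> j * (1 - \<alpha> i) * ((1 + \<alpha> i) / (\<alpha> j + 2 * \<alpha> i))"
        unfolding ratio \<alpha>(3) by (simp add: power2_eq_square algebra_simps add_divide_distrib diff_divide_distrib)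
      also have "\<dots> \<le> \<alpha> j * (1 - \<alpha> i) * 1"
        using pair[OF that] \<alpha>[of i] \<alpha>[of j] pos by (intro mult_left_mono) auto
      finally show ?thesis by simp
    qed
    have "(\<Sum>i\<in>UNIV. (\<sigma> i)\<^sup>2 * (a j / (a j + (if i = j then 0 else 2 * a i))))
        = (\<sigma> j)\<^sup>2 + (\<Sum>i\<in>UNIV - {j}. (\<sigma> i)\<^sup>2 * (a j / (a j + 2 * a i)))"
      using a(1)[of j] by (subst sum.remove[of _ j]) auto
    also have "\<dots> \<le> (\<sigma> j)\<^sup>2 + (\<Sum>i\<in>UNIV - {j}. \<alpha> j * (1 - \<alpha> i))"
      using off_diag by (intro add_left_mono sum_mono) auto
    also have "(\<Sum>i\<in>UNIV - {j}. \<alpha> j * (1 - \<alpha> i)) = \<alpha> j * (\<alpha> j - \<delta>)"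
      by (simp add: \<delta>_defect sum.remove[of UNIV j "\<lambda>i. 1 - \<alpha> i"] flip: sum_distrib_left)
    also have "(\<sigma> j)\<^sup>2 + \<alpha> j * (\<alpha> j - \<delta>) = 1 - 2 * a j"
      unfolding \<alpha>(3) by (simp add: a_def power2_eq_square algebra_simps)
    also have "\<dots> \<le> 1 - a j" using a(1)[of j] by simp
    finally show ?thesis .
  qed
  with a show ?thesis by blast
qed

section \<open>Growth, zeros of the denominator, and the sphere map\<close>

text \<open>
  Read contrapositively: if \<open>\<parallel>P\<parallel>\<^sup>2\<close> grows faster than \<open>norm z ^ (2 * d)\<close>, then some component has degree
  above \<open>d\<close>. This gives a lower bound on the degree without looking at leading terms.
\<close>
lemma sum_of_squares_growth:
  fixes P :: "nat \<Rightarrow> 'n::finite cpoly"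
  assumes "\<And>k. k < N \<Longrightarrow> cpoly_degree (P k) \<le> d"
  shows "\<exists>K\<ge>0. \<forall>z. 1 \<le> norm z \<longrightarrow>
    (\<Sum>k<N. (cmod (cpoly_eval (P k) z))\<^sup>2) \<le> K * norm z ^ (2 * d)"
proof -
  have "\<forall>k. \<exists>C\<ge>0. \<forall>z. 1 \<le> norm z \<longrightarrow>
      cmod (cpoly_eval (P k) z) \<le> C * norm z ^ cpoly_degree (P k)"
    using cpoly_growth_bound by blast
  then obtain C where C: "\<And>k. C k \<ge> 0"
    "\<And>k z. 1 \<le> norm z \<Longrightarrow> cmod (cpoly_eval (P k) z) \<le> C k * norm z ^ cpoly_degree (P k)"
    by metis
  have "(\<Sum>k<N. (cmod (cpoly_eval (P k) z))\<^sup>2) \<le> (\<Sum>k<N. (C k)\<^sup>2) * norm z ^ (2 * d)"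
    if z: "1 \<le> norm z" for z
    unfolding sum_distrib_right
  proof (rule sum_mono)
    fix k assume k: "k \<in> {..<N}"
    have "cmod (cpoly_eval (P k) z) \<le> C k * norm z ^ d"
      using C(2)[OF z, of k] power_increasing[OF assms[of k] z] k C(1)[of k]
      by (meson lessThan_iff mult_left_mono order_trans)
    then have "(cmod (cpoly_eval (P k) z))\<^sup>2 \<le> (C k * norm z ^ d)\<^sup>2"
      by (intro power_mono) auto
    then show "(cmod (cpoly_eval (P k) z))\<^sup>2 \<le> (C k)\<^sup>2 * norm z ^ (2 * d)"
      by (simp add: power_mult_distrib mult.commute flip: power_mult)
  qed
  then show ?thesis
    by (intro exI[of _ "\<Sum>k<N. (C k)\<^sup>2"]) (simp add: sum_nonneg)
qed

lemma quadratic_denominator_nonzero: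
  fixes \<sigma> :: "'n::finite \<Rightarrow> real"
  assumes \<sigma>: "\<And>j. 0 \<le> \<sigma> j" "\<And>j. \<sigma> j < 1" and z: "norm z \<le> 1"
  shows "1 + (\<Sum>j\<in>UNIV. of_real (\<sigma> j) * (z $ j)\<^sup>2) \<noteq> (0 :: complex)"
proof
  assume "1 + (\<Sum>j\<in>UNIV. of_real (\<sigma> j) * (z $ j)\<^sup>2) = (0 :: complex)"
  then have "cmod (\<Sum>j\<in>UNIV. of_real (\<sigma> j) * (z $ j)\<^sup>2) = 1"
    by (metis add_eq_0_iff norm_minus_cancel norm_one)
  moreover have "cmod (\<Sum>j\<in>UNIV. of_real (\<sigma> j) * (z $ j)\<^sup>2) \<le> Max (range \<sigma>)"
  proof -
    have "0 \<le> Max (range \<sigma>)"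
      using \<sigma>(1) by (meson Max_ge finite_code finite_imageI order_trans rangeI)
    have "cmod (\<Sum>j\<in>UNIV. of_real (\<sigma> j) * (z $ j)\<^sup>2) \<le> (\<Sum>j\<in>UNIV. cmod (of_real (\<sigma> j) * (z $ j)\<^sup>2))"
      by (rule norm_sum)
    also have "\<dots> \<le> (\<Sum>j\<in>UNIV. Max (range \<sigma>) * (cmod (z $ j))\<^sup>2)"
      using \<sigma>(1) by (intro sum_mono) (simp add: norm_mult norm_power mult_right_mono)
    also have "\<dots> = Max (range \<sigma>) * (norm z)\<^sup>2"
      by (simp add: norm_power2_eq_sum sum_distrib_left)
    also have "\<dots> \<le> Max (range \<sigma>) * 1"
      using z \<open>0 \<le> Max (range \<sigma>)\<close> by (intro mult_left_mono) (auto simp: power_le_one)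
    finally show ?thesis by simp
  qed
  moreover have "Max (range \<sigma>) < 1"
    using \<sigma>(2) by (subst Max_less_iff) auto
  ultimately show False by simp
qed

theorem theorem6p2:
  fixes \<sigma> :: "'n::finite \<Rightarrow> real"
  assumes "CARD('n) \<ge> 2"
    and "\<And>j. 0 \<le> \<sigma> j"
    and "\<And>j. \<sigma> j < 1"
    and "(\<Sum>j\<in>UNIV. sqrt (1 - (\<sigma> j)\<^sup>2)) > real CARD('n) - 1"
  shows "\<exists>N F P g.
           g = 1 + (\<Sum>j\<in>UNIV. cpoly_const (complex_of_real (\<sigma> j)) * (cpoly_var j :: 'n cpoly)\<^sup>2) \<and>
           sphere_map N F P g \<and> (\<forall>z\<in>ball 0 1. (\<Sum>k<N. (cmod (F k z))\<^sup>2) < 1) \<and>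
           reduced_map N P g \<and> pointed_map N P g \<and> map_degree N P g = 3"
proof -
  define g where "g = 1 + (\<Sum>j\<in>UNIV. cpoly_const (complex_of_real (\<sigma> j)) * (cpoly_var j :: 'n cpoly)\<^sup>2)"
  have g_eval: "cpoly_eval g z = 1 + (\<Sum>j\<in>UNIV. of_real (\<sigma> j) * (z $ j)\<^sup>2)" for z
    by (simp add: g_def)
  have g_nz: "cpoly_eval g z \<noteq> 0" if "norm z \<le> 1" for z
    unfolding g_eval using assms(2,3) that by (rule quadratic_denominator_nonzero)
  obtain a where a: "\<And>j. 0 < a j" "\<And>j. a j < 1"
    and a_ineq: "\<And>j. (\<Sum>i\<in>UNIV. (\<sigma> i)\<^sup>2 * (a j / (a j + (if i = j then 0 else 2 * a i)))) \<le> 1 - a j"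
    using weights_for_cubic_form[OF assms(2-4)] by blast
  define A where "A z = (\<Sum>j\<in>UNIV. a j * (cmod (z $ j))\<^sup>2)" for z :: "complex ^ 'n"
  have A_ge: "a j * (cmod (z $ j))\<^sup>2 \<le> A z" for z j
    unfolding A_def using a(1) by (intro member_le_sum) (auto simp: less_imp_le)
  have A_nonneg: "0 \<le> A z" for z
    unfolding A_def using a(1) by (intro sum_nonneg) (simp add: less_imp_le)
  have A_pos: "0 < A z" if z: "z \<noteq> 0" for z
  proof -
    obtain j where "z $ j \<noteq> 0" using z by (auto simp: vec_eq_iff)
    then have "0 < a j * (cmod (z $ j))\<^sup>2" using a(1) by simp
    then show ?thesis using A_ge by (rule less_le_trans)
  qed
  obtain N :: nat and P :: "nat \<Rightarrow> 'n cpoly" where P_deg: "\<And>k. k < N \<Longrightarrow> cpoly_degree (P k) \<le> 3"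
    and P: "\<And>z. (\<Sum>k<N. (cmod (cpoly_eval (P k) z))\<^sup>2) =
      (norm z)\<^sup>2 * (cmod (cpoly_eval g z))\<^sup>2 - (1 - norm z ^ 4) * A z"
    using cubic_form_sos[OF a a_ineq] unfolding hermitian_sos_def g_eval A_def by metis

  have sphere: "sphere_map N (\<lambda>k z. cpoly_eval (P k) z / cpoly_eval g z) P g"
    unfolding sphere_map_def
  proof (intro conjI allI impI ballI)
    show "g \<noteq> 0" using g_nz[of 0] by auto
    show "holomorphic_multi_on (\<lambda>z. cpoly_eval (P k) z / cpoly_eval g z) (ball 0 1)" for k
      using g_nz by (intro holomorphic_multi_on_divide holomorphic_multi_on_cpoly_eval) auto
    show "cpoly_eval g z * (cpoly_eval (P k) z / cpoly_eval g z) = cpoly_eval (P k) z"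
      if "z \<in> ball 0 1" for k z
      using g_nz[of z] that by simp
    show "(\<Sum>k<N. (cmod (cpoly_eval (P k) z))\<^sup>2) = (cmod (cpoly_eval g z))\<^sup>2"
      if "z \<in> sphere 0 1" for z
      using that by (simp add: P)
  qed

  have into_ball: "(\<Sum>k<N. (cmod (cpoly_eval (P k) z / cpoly_eval g z))\<^sup>2) < 1"
    if z: "z \<in> ball 0 1" for z
  proof -
    have g_pos: "0 < (cmod (cpoly_eval g z))\<^sup>2" using g_nz[of z] z by simp
    have "(norm z)\<^sup>2 < 1" using z by (simp add: power_less_one_iff)
    then have "(norm z)\<^sup>2 * (cmod (cpoly_eval g z))\<^sup>2 < 1 * (cmod (cpoly_eval g z))\<^sup>2"
      using g_pos by (rule mult_strict_right_mono)
    moreover have "0 \<le> (1 - norm z ^ 4) * A z"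
      using z A_nonneg[of z] by (simp add: power_le_one)
    ultimately have "(\<Sum>k<N. (cmod (cpoly_eval (P k) z))\<^sup>2) < (cmod (cpoly_eval g z))\<^sup>2"
      by (simp add: P)
    then show ?thesis
      using g_pos by (simp add: norm_divide power_divide flip: sum_divide_distrib)
  qed

  have reduced: "reduced_map N P g"
    unfolding reduced_map_def
  proof (intro allI impI, rule ccontr)
    fix h :: "'n cpoly"
    \<comment> \<open>A zero of \<open>h\<close> would be a common zero of \<open>g\<close> and \<open>P\<close>. Zeros of \<open>g\<close> lie outside the closed ball,
      and there the identity for \<open>\<parallel>P\<parallel>\<^sup>2\<close> forces \<open>P\<close> to be nonzero.\<close>
    assume h: "h dvd g" "\<forall>k<N. h dvd P k" and nonconst: "cpoly_degree h \<noteq> 0"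
    obtain z where z: "cpoly_eval h z = 0"
      using nonconstant_cpoly_has_zero[OF nonconst] by blast
    have zero: "cpoly_eval p z = 0" if "h dvd p" for p
      using that z by (auto elim: dvdE)
    have "norm z > 1"
      using g_nz[of z] zero[OF h(1)] by force
    then have "1 < norm z ^ 4" "z \<noteq> 0" by auto
    then have "0 < (norm z ^ 4 - 1) * A z" using A_pos by simp
    moreover have "(\<Sum>k<N. (cmod (cpoly_eval (P k) z))\<^sup>2) = 0"
      using zero h(2) by (intro sum.neutral) auto
    moreover have "(\<Sum>k<N. (cmod (cpoly_eval (P k) z))\<^sup>2) = (norm z ^ 4 - 1) * A z"
      unfolding P zero[OF h(1)] by (simp add: algebra_simps)
    ultimately show False by simp
  qed

  have pointed: "pointed_map N P g"
    unfolding pointed_map_def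
  proof (intro conjI allI impI)
    show "cpoly_eval g 0 = 1" by (simp add: g_eval)
    fix k assume "k < N"
    have "(\<Sum>k<N. (cmod (cpoly_eval (P k) 0))\<^sup>2) = 0"
      by (simp add: P A_def)
    then have "\<forall>k\<in>{..<N}. (cmod (cpoly_eval (P k) 0))\<^sup>2 = 0"
      by (subst (asm) sum_nonneg_eq_0_iff) auto
    then show "cpoly_eval (P k) 0 = 0" using \<open>k < N\<close> by simp
  qed

  have g_deg: "cpoly_degree g \<le> 2"
    unfolding g_def
  proof (intro cpoly_degree_add_le cpoly_degree_sum_le)
    show "cpoly_degree (1 :: 'n cpoly) \<le> 2" by simp
    show "cpoly_degree (cpoly_const (complex_of_real (\<sigma> j)) * (cpoly_var j :: 'n cpoly)\<^sup>2) \<le> 2" for j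
      using cpoly_degree_power_le[of "cpoly_var j :: 'n cpoly" 1 2]
      by (intro order_trans[OF cpoly_degree_mult_le[of _ 0 _ 2]]) simp_all
  qed
  have "\<exists>k<N. cpoly_degree (P k) = 3"
  proof (rule ccontr)
    assume "\<not> ?thesis"
    then have "cpoly_degree (P k) \<le> 2" if "k < N" for k
      using P_deg[OF that] that by force
    then obtain K where K: "K \<ge> 0" "\<And>z. 1 \<le> norm z \<Longrightarrow>
        (\<Sum>k<N. (cmod (cpoly_eval (P k) z))\<^sup>2) \<le> K * norm z ^ 4"
      using sum_of_squares_growth[of N P 2] by auto
    \<comment> \<open>On a coordinate axis \<open>\<parallel>P\<parallel>\<^sup>2\<close> is at least \<open>a j * T * (T\<^sup>2 - 1)\<close> at \<open>(norm z)\<^sup>2 = T\<close>, which beats \<open>K * T\<^sup>2\<close>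
      for this choice of \<open>T\<close>. The axis is arbitrary.\<close>
    define j where "j = (undefined :: 'n)"
    define T where "T = K / a j + 2"
    have T: "T \<ge> 2" using K(1) a(1)[of j] by (simp add: T_def)
    define z where "z = (axis j (of_real (sqrt T)) :: complex ^ 'n)"
    have "(norm z)\<^sup>2 = (\<Sum>i\<in>UNIV. if i = j then T else 0)"
      unfolding norm_power2_eq_sum using T by (intro sum.cong) (auto simp: z_def axis_def)
    then have n2: "(norm z)\<^sup>2 = T" by simp
    then have n4: "norm z ^ 4 = T\<^sup>2" and norm_z: "norm z \<ge> 1"
      using T power_mult[of "norm z" 2 2] power_le_one_iff[of "norm z" 2] by auto
    have "(T\<^sup>2 - 1) * (a j * T) \<le> (T\<^sup>2 - 1) * A z"
      using A_ge[of j z] T by (intro mult_left_mono) (simp_all add: z_def axis_def)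
    also have "\<dots> \<le> (\<Sum>k<N. (cmod (cpoly_eval (P k) z))\<^sup>2)"
      using T by (simp add: P n2 n4 algebra_simps)
    also have "\<dots> \<le> K * T\<^sup>2"
      using K(2)[OF norm_z] by (simp add: n4)
    also have "K = a j * (T - 2)"
      using a(1)[of j] by (simp add: T_def)
    finally have "(a j * T) * (T\<^sup>2 - 1) \<le> (a j * T) * (T * (T - 2))"
      by (simp add: power2_eq_square algebra_simps)
    then have "T\<^sup>2 - 1 \<le> T * (T - 2)"
      using T a(1)[of j] by (subst (asm) mult_le_cancel_left_pos) auto
    then show False using T by (simp add: power2_eq_square algebra_simps)
  qed
  then obtain k where k: "k < N" "cpoly_degree (P k) = 3" by blast
  have degree: "map_degree N P g = 3"
    unfolding map_degree_def
  proof (rule Max_eqI)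
    show "3 \<in> insert (cpoly_degree g) ((\<lambda>k. cpoly_degree (P k)) ` {..<N})"
      using k by (metis image_eqI insertCI lessThan_iff)
  qed (use g_deg P_deg in auto)

  show ?thesis
    using g_def sphere into_ball reduced pointed degree by blast
qed

end
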